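(* Let $\mathcal{L}$ be an operator on $\mathbb{R}^n$ satisfying the standing assumptions listed in the context. Let $f:\mathbb{R}\to\mathbb{R}$ be a $C^1$ increasing function such that $f^{-1}(\{0\})=\{0\}$, and define $F:\mathbb{R}\to\mathbb{R}$ by $F(t)=\int_0^t f(s)\,ds$. Let $u\in C^2(\mathbb{R}^n,\mathbb{R})$ be a classical solution to $\mathcal{L}u=f(u)$ in $\mathbb{R}^n$. If $F(u)\in L^1(\mathbb{R}^n)$, then $u\equiv 0$.
   Context: Standing assumptions. $\mathcal{L}:=\mathrm{div}(A\nabla)+\langle b,\nabla\rangle$ is a linear second order partial differential operator on $\mathbb{R}^n$, where $A=(a_{ij})_{i,j=1,\dots,n}$ is a symmetric $n\times n$ matrix with entries $a_{ij}\in C^\infty(\mathbb{R}^n,\mathbb{R})$, $b=(b_1,\dots,b_n)$ has components $b_j\in C^\infty(\mathbb{R}^n,\mathbb{R})$, and $\mathrm{div}$, $\nabla$, $\langle\cdot,\cdot\rangle$ are the Euclidean divergence, gradient and inner product. It is assumed that $\langle A(x)\xi,\xi\rangle\ge 0$ for all $x,\xi\in\mathbb{R}^n$ and $\mathrm{trace}\,A(0)>0$. Moreover: (1) $\mathcal{L}$ is hypoelliptic: if $w$ is a distribution on an open set $\Omega\subseteq\mathbb{R}^n$ and $\mathcal{L}w$ is smooth in $\Omega$, then $w$ is smooth in $\Omega$. (2) There is a Lie group $\mathbb{G}=(\mathbb{R}^n,\circ)$ such that $\mathcal{L}$ is left translation invariant on $\mathbb{G}$, i.e. $\mathcal{L}(w(\alpha\circ\cdot))(x)=(\mathcal{L}w)(\alpha\circ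 x)$ for all $\alpha,x\in\mathbb{R}^n$ and all $w\in C^\infty(\mathbb{R}^n,\mathbb{R})$. (3) The Lebesgue measure on $\mathbb{R}^n$ is both left and right invariant on $\mathbb{G}$. $L^1$ is taken with respect to Lebesgue measure; $F(u)$ denotes the composition $x\mapsto F(u(x))$. *)

theory Defs
  imports "HOL-Analysis.Analysis"
begin

section \<open>Functions of class $C^k$ and smooth functions\<close>

text \<open>
  On an open set \<open>S\<close>, \<open>Ck_on k S f\<close> says that \<open>f\<close> is \<open>k\<close> times continuously differentiable:
  all directional derivatives of the Frechet derivative are again of class \<open>k - 1\<close>.
  It is only meant for open \<open>S\<close>.
\<close>

primrec Ck_on ::
  "nat \<Rightarrow> 'a::real_normed_vector set \<Rightarrow> ('a \<Rightarrow> 'b::real_normed_vector) \<Rightarrow> bool" where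
  "Ck_on 0 S f \<longleftrightarrow> continuous_on S f"
| "Ck_on (Suc k) S f \<longleftrightarrow>
     (\<forall>x\<in>S. f differentiable (at x)) \<and>
     (\<forall>v. Ck_on k S (\<lambda>x. frechet_derivative f (at x) v))"

definition smooth_on :: "'a::real_normed_vector set \<Rightarrow> ('a \<Rightarrow> 'b::real_normed_vector) \<Rightarrow> bool" where
  "smooth_on S f \<longleftrightarrow> (\<forall>k. Ck_on k S f)"

section \<open>The differential operator\<close>

definition partial_deriv :: "'n::finite \<Rightarrow> (real^'n \<Rightarrow> real) \<Rightarrow> real^'n \<Rightarrow> real" where
  "partial_deriv i f x = frechet_derivative f (at x) (axis i 1)"

definition gradient :: "(real^'n::finite \<Rightarrow> real) \<Rightarrow> real^'n \<Rightarrow> real^'n" where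
  "gradient f x = (\<chi> i. partial_deriv i f x)"

definition divergence :: "(real^'n::finite \<Rightarrow> real^'n) \<Rightarrow> real^'n \<Rightarrow> real" where
  "divergence V x = (\<Sum>i\<in>UNIV. partial_deriv i (\<lambda>y. V y $ i) x)"

definition diff_op ::
  "(real^'n::finite \<Rightarrow> real^'n^'n) \<Rightarrow> (real^'n \<Rightarrow> real^'n) \<Rightarrow> (real^'n \<Rightarrow> real) \<Rightarrow> real^'n \<Rightarrow> real" where
  "diff_op A b w x = divergence (\<lambda>y. A y *v gradient w y) x + b x \<bullet> gradient w x"

section \<open>Distributions and hypoellipticity\<close>

definition test_functions :: "(real^'n::finite) set \<Rightarrow> (real^'n \<Rightarrow> real) set" where
  "test_functions \<Omega> = {\<phi>. smooth_on UNIV \<phi> \<and>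
     compact (closure (support_on UNIV \<phi>)) \<and> closure (support_on UNIV \<phi>) \<subseteq> \<Omega>}"

text \<open>
  A list of indices, in place of a multi-index, names an iterated partial derivative. Partial
  derivatives of smooth functions commute, so the order of the list is irrelevant.
\<close>

definition iter_partial :: "'n::finite list \<Rightarrow> (real^'n \<Rightarrow> real) \<Rightarrow> real^'n \<Rightarrow> real" where
  "iter_partial is f = foldr partial_deriv is f"

text \<open>
  A distribution on \<open>\<Omega>\<close> is a linear functional on the test functions on \<open>\<Omega>\<close> with the usual seminorm
  estimate on every compact subset. Functionals are total in HOL; only
  their values on \<open>test_functions \<Omega>\<close> are ever used.
\<close>

definition distribution_on ::
  "(real^'n::finite) set \<Rightarrow> ((real^'n \<Rightarrow> real) \<Rightarrow> real) \<Rightarrow> bool" where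
  "distribution_on \<Omega> T \<longleftrightarrow>
     (\<forall>\<phi>\<in>test_functions \<Omega>. \<forall>\<psi>\<in>test_functions \<Omega>. T (\<lambda>x. \<phi> x + \<psi> x) = T \<phi> + T \<psi>) \<and>
     (\<forall>\<phi>\<in>test_functions \<Omega>. \<forall>c. T (\<lambda>x. c * \<phi> x) = c * T \<phi>) \<and>
     (\<forall>K. compact K \<and> K \<subseteq> \<Omega> \<longrightarrow>
        (\<exists>C N. \<forall>\<phi>\<in>test_functions \<Omega>. closure (support_on UNIV \<phi>) \<subseteq> K \<longrightarrow>
           \<bar>T \<phi>\<bar> \<le> C * (\<Sum>is\<in>{is. length is \<le> N}. SUP x. \<bar>iter_partial is \<phi> x\<bar>)))"

definition dist_partial ::
  "'n::finite \<Rightarrow> ((real^'n \<Rightarrow> real) \<Rightarrow> real) \<Rightarrow> (real^'n \<Rightarrow> real) \<Rightarrow> real" where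
  "dist_partial i T \<phi> = - T (partial_deriv i \<phi>)"

definition dist_mult ::
  "(real^'n::finite \<Rightarrow> real) \<Rightarrow> ((real^'n \<Rightarrow> real) \<Rightarrow> real) \<Rightarrow> (real^'n \<Rightarrow> real) \<Rightarrow> real" where
  "dist_mult g T \<phi> = T (\<lambda>x. g x * \<phi> x)"

definition dist_diff_op ::
  "(real^'n::finite \<Rightarrow> real^'n^'n) \<Rightarrow> (real^'n \<Rightarrow> real^'n) \<Rightarrow>
     ((real^'n \<Rightarrow> real) \<Rightarrow> real) \<Rightarrow> (real^'n \<Rightarrow> real) \<Rightarrow> real" where
  "dist_diff_op A b T \<phi> =
     (\<Sum>i\<in>UNIV. dist_partial i
        (\<lambda>\<psi>. \<Sum>j\<in>UNIV. dist_mult (\<lambda>x. A x $ i $ j) (dist_partial j T) \<psi>) \<phi>) +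
     (\<Sum>j\<in>UNIV. dist_mult (\<lambda>x. b x $ j) (dist_partial j T) \<phi>)"

definition smooth_distribution_on ::
  "(real^'n::finite) set \<Rightarrow> ((real^'n \<Rightarrow> real) \<Rightarrow> real) \<Rightarrow> bool" where
  "smooth_distribution_on \<Omega> T \<longleftrightarrow>
     (\<exists>g. smooth_on \<Omega> g \<and> (\<forall>\<phi>\<in>test_functions \<Omega>. T \<phi> = (LINT x:\<Omega>|lebesgue. g x * \<phi> x)))"

definition hypoelliptic ::
  "(real^'n::finite \<Rightarrow> real^'n^'n) \<Rightarrow> (real^'n \<Rightarrow> real^'n) \<Rightarrow> bool" where
  "hypoelliptic A b \<longleftrightarrow>
     (\<forall>\<Omega> T. open \<Omega> \<longrightarrow> distribution_on \<Omega> T \<longrightarrow>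
        smooth_distribution_on \<Omega> (dist_diff_op A b T) \<longrightarrow> smooth_distribution_on \<Omega> T)"

section \<open>Lie group structures on Euclidean space\<close>

text \<open>
  The manifold structure is the standard one; the neutral element is not required to be the origin.
\<close>

definition Lie_group_op :: "(real^'n::finite \<Rightarrow> real^'n \<Rightarrow> real^'n) \<Rightarrow> bool" where
  "Lie_group_op m \<longleftrightarrow>
     (\<exists>e inver. group m e inver \<and> smooth_on UNIV (\<lambda>(x, y). m x y) \<and> smooth_on UNIV inver)"

definition left_translation_invariant ::
  "(real^'n::finite \<Rightarrow> real^'n \<Rightarrow> real^'n) \<Rightarrow> ((real^'n \<Rightarrow> real) \<Rightarrow> real^'n \<Rightarrow> real) \<Rightarrow> bool" where
  "left_translation_invariant m L \<longleftrightarrow>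
     (\<forall>w \<alpha> x. smooth_on UNIV w \<longrightarrow> L (\<lambda>y. w (m \<alpha> y)) x = L w (m \<alpha> x))"

end

theory Submission
  imports Defs
begin

text \<open>
  The function \<open>v = F \<circ> u\<close> is integrable and satisfies
  \<open>L v = f'(u) \<langle>A \<nabla>u, \<nabla>u\<rangle> + f(u)\<^sup>2 \<ge> f(u)\<^sup>2\<close>, so it suffices that an integrable \<open>v\<close> with \<open>L v \<ge> 0\<close>
  has \<open>L v = 0\<close>. For a nonnegative bump \<open>\<phi>\<close>, left invariance of \<open>L\<close> and of Lebesgue measure give
  \<open>\<integral> L v(x) \<phi>(\<alpha> x) dx = \<integral> v(x) L\<^sup>*\<phi>(\<alpha> x) dx\<close> for every \<open>\<alpha>\<close>. By Fubini and right invariance of the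
  measure, integrating the right-hand side over \<open>\<alpha>\<close> yields \<open>(\<integral> v) (\<integral> L\<^sup>*\<phi>)\<close>, which vanishes because \<open>L\<^sup>*\<phi>\<close>
  is a divergence; the left-hand side is nonnegative, hence zero for almost every \<open>\<alpha>\<close>.
\<close>

section \<open>Calculus of functions of class $C^k$\<close>

text \<open>Uniqueness of the Frechet derivative lets an explicitly computed derivative stand in for
  the choice inside \<open>frechet_derivative\<close>. The closure properties below that compute a
  derivative by hand go through this rule.\<close>

lemma Ck_on_SucI:
  assumes "\<And>x. (f has_derivative f' x) (at x)"
    and "\<And>v. Ck_on k UNIV (\<lambda>x. f' x v)"
  shows "Ck_on (Suc k) UNIV f"
proof -
  have "frechet_derivative f (at x) = f' x" for x
    using frechet_derivative_at[OF assms(1)] by simp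
  then show ?thesis using assms by (auto simp: differentiable_def)
qed

lemma Ck_on_Suc_imp: "Ck_on (Suc k) S f \<Longrightarrow> Ck_on k S f"
proof (induction k arbitrary: f)
  case 0
  then show ?case
    by (auto intro!: continuous_at_imp_continuous_on differentiable_imp_continuous_within)
qed auto

lemma Ck_on_mono: "Ck_on k S f \<Longrightarrow> j \<le> k \<Longrightarrow> Ck_on j S f"
  by (induction k) (auto simp: le_Suc_eq dest: Ck_on_Suc_imp simp del: Ck_on.simps)

lemma Ck_on_imp_continuous: "Ck_on k S f \<Longrightarrow> continuous_on S f"
  using Ck_on_mono[of k S f 0] by simp

lemma Ck_on_has_derivative:
  "Ck_on (Suc k) UNIV f \<Longrightarrow> (f has_derivative frechet_derivative f (at x)) (at x)"
  by (simp add: frechet_derivative_works)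

lemma Ck_on_frechet: "Ck_on (Suc k) S f \<Longrightarrow> Ck_on k S (\<lambda>x. frechet_derivative f (at x) v)"
  by simp

lemma Ck_on_const: "Ck_on k UNIV (\<lambda>x. c)"
  by (induction k arbitrary: c) auto

lemma Ck_on_affine:
  assumes "bounded_linear l"
  shows "Ck_on k UNIV (\<lambda>x. c + l x)"
proof (cases k)
  case 0
  then show ?thesis
    by (simp add: continuous_on_add linear_continuous_on[OF assms])
next
  case (Suc j)
  have "((\<lambda>x. c + l x) has_derivative l) (at x)" for x
    using bounded_linear.has_derivative[OF assms has_derivative_ident]
    by (auto intro!: derivative_eq_intros)
  then show ?thesis unfolding Suc by (rule Ck_on_SucI) (rule Ck_on_const)
qed

lemma Ck_on_bounded_linear: "bounded_linear l \<Longrightarrow> Ck_on k UNIV l"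
  using Ck_on_affine[of l k 0] by simp

lemma Ck_on_linear_compose:
  assumes "bounded_linear l"
  shows "Ck_on k UNIV f \<Longrightarrow> Ck_on k UNIV (\<lambda>x. l (f x))"
proof (induction k arbitrary: f)
  case 0
  then show ?case using assms
    by (auto intro: bounded_linear.continuous_on)
next
  case (Suc k)
  show ?case
    by (rule Ck_on_SucI[OF bounded_linear.has_derivative[OF assms Ck_on_has_derivative[OF Suc.prems]]])
      (rule Suc.IH[OF Ck_on_frechet[OF Suc.prems]])
qed

lemma Ck_on_compose_affine:
  assumes "bounded_linear l"
  shows "Ck_on k UNIV f \<Longrightarrow> Ck_on k UNIV (\<lambda>x. f (c + l x))"
proof (induction k arbitrary: f)
  case 0
  then have f: "continuous_on UNIV f" by simp
  show ?case
    by (simp add: continuous_on_compose2[OF f] continuous_on_add linear_continuous_on[OF assms])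
next
  case (Suc k)
  have l: "((\<lambda>x. c + l x) has_derivative l) (at x)" for x
    using bounded_linear.has_derivative[OF assms has_derivative_ident]
    by (auto intro!: derivative_eq_intros)
  show ?case
    by (rule Ck_on_SucI[OF has_derivative_compose[OF l Ck_on_has_derivative[OF Suc.prems]]])
      (rule Suc.IH[OF Ck_on_frechet[OF Suc.prems]])
qed

lemma Ck_on_add:
  "Ck_on k UNIV f \<Longrightarrow> Ck_on k UNIV g \<Longrightarrow> Ck_on k UNIV (\<lambda>x. f x + g x)"
proof (induction k arbitrary: f g)
  case (Suc k)
  show ?case
    by (rule Ck_on_SucI[OF has_derivative_add[OF Suc.prems[THEN Ck_on_has_derivative]]])
      (rule Suc.IH[OF Suc.prems[THEN Ck_on_frechet]])
qed (simp add: continuous_on_add)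

lemma Ck_on_scaleR:
  "Ck_on k UNIV f \<Longrightarrow> Ck_on k UNIV g \<Longrightarrow> Ck_on k UNIV (\<lambda>x. f x *\<^sub>R g x)"
proof (induction k arbitrary: f g)
  case (Suc k)
  have fg: "Ck_on k UNIV f" "Ck_on k UNIV g" using Suc.prems by (blast dest: Ck_on_Suc_imp)+
  show ?case
    by (rule Ck_on_SucI[OF has_derivative_scaleR[OF Suc.prems[THEN Ck_on_has_derivative]]])
      (intro Ck_on_add Suc.IH fg Suc.prems[THEN Ck_on_frechet])
qed (simp add: continuous_on_scaleR)

lemma Ck_on_mult:
  fixes f g :: "_ \<Rightarrow> real"
  shows "Ck_on k UNIV f \<Longrightarrow> Ck_on k UNIV g \<Longrightarrow> Ck_on k UNIV (\<lambda>x. f x * g x)"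
  using Ck_on_scaleR[of k f g] by simp

lemma Ck_on_minus: "Ck_on k UNIV f \<Longrightarrow> Ck_on k UNIV (\<lambda>x. - f x)"
  using Ck_on_linear_compose[OF bounded_linear_minus[OF bounded_linear_ident]] by auto

lemma Ck_on_diff:
  "Ck_on k UNIV f \<Longrightarrow> Ck_on k UNIV g \<Longrightarrow> Ck_on k UNIV (\<lambda>x. f x - g x)"
  using Ck_on_add[OF _ Ck_on_minus, of k f g] by simp

lemma Ck_on_sum:
  "(\<And>i. i \<in> I \<Longrightarrow> Ck_on k UNIV (f i)) \<Longrightarrow> Ck_on k UNIV (\<lambda>x. \<Sum>i\<in>I. f i x)"
  by (induction I rule: infinite_finite_induct) (auto simp: Ck_on_const Ck_on_add)

text \<open>In a chain rule the vector fed to the outer derivative moves with the base point,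
  whereas \<open>Ck_on\<close> speaks of fixed directions. Expanding over the basis trades the
  moving vector for scalar coefficients times derivatives in fixed directions.\<close>

lemma has_derivative_expand_Basis:
  fixes v :: "'a::euclidean_space"
  assumes "(f has_derivative f') F"
  shows "f' v = (\<Sum>e\<in>Basis. (v \<bullet> e) *\<^sub>R f' e)"
proof -
  have l: "linear f'" using assms by (rule has_derivative_linear)
  have "f' v = f' (\<Sum>e\<in>Basis. (v \<bullet> e) *\<^sub>R e)" by (simp only: euclidean_representation)
  then show ?thesis by (simp add: linear_sum[OF l] linear_scale[OF l])
qed

lemma Ck_on_compose:
  fixes g :: "_ \<Rightarrow> 'b::euclidean_space"
  shows "Ck_on k UNIV f \<Longrightarrow> Ck_on k UNIV g \<Longrightarrow> Ck_on k UNIV (\<lambda>x. f (g x))"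
proof (induction k arbitrary: f)
  case 0
  then show ?case by (auto intro: continuous_on_compose2)
next
  case (Suc k)
  note f = Ck_on_has_derivative[OF Suc.prems(1)] and g = Ck_on_has_derivative[OF Suc.prems(2)]
  have g0: "Ck_on k UNIV g" using Suc.prems by (blast dest: Ck_on_Suc_imp)
  show ?case
  proof (rule Ck_on_SucI[OF has_derivative_compose[OF g f]])
    fix v
    \<comment> \<open>With \<open>e\<close> fixed, the induction hypothesis applies to the
      derivative of \<open>f\<close> along \<open>e\<close> composed with \<open>g\<close>; the
      coefficients are components of derivatives of \<open>g\<close>.\<close>
    have "Ck_on k UNIV (\<lambda>x. \<Sum>e\<in>Basis.
        (frechet_derivative g (at x) v \<bullet> e) *\<^sub>R frechet_derivative f (at (g x)) e)"
      by (intro Ck_on_sum Ck_on_scaleR Suc.IH g0 Suc.prems(1)[THEN Ck_on_frechet]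
          Ck_on_linear_compose[OF bounded_linear_inner_left] Suc.prems(2)[THEN Ck_on_frechet])
    then show "Ck_on k UNIV (\<lambda>x. frechet_derivative f (at (g x)) (frechet_derivative g (at x) v))"
      by (subst has_derivative_expand_Basis[OF f])
  qed
qed

lemma Ck_on_compose_real:
  fixes h :: "real \<Rightarrow> real"
  shows "Ck_on k UNIV h \<Longrightarrow> Ck_on k UNIV f \<Longrightarrow> Ck_on k UNIV (\<lambda>x. h (f x))"
  by (rule Ck_on_compose)

lemma Ck_on_Suc_realI:
  fixes h h' :: "real \<Rightarrow> real"
  assumes "\<And>x. (h has_real_derivative h' x) (at x)" and "Ck_on k UNIV h'"
  shows "Ck_on (Suc k) UNIV h"
  by (rule Ck_on_SucI[OF assms(1)[unfolded has_field_derivative_def]])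
    (intro Ck_on_mult assms Ck_on_const)

lemma Ck_on_component: "Ck_on k UNIV g \<Longrightarrow> Ck_on k UNIV (\<lambda>x. g x $ i)"
  by (rule Ck_on_linear_compose[OF bounded_linear_vec_nth])

section \<open>Algebraic rules for partial derivatives\<close>

lemma partial_deriv_eq: "(f has_derivative f') (at x) \<Longrightarrow> partial_deriv i f x = f' (axis i 1)"
  unfolding partial_deriv_def by (simp add: frechet_derivative_at[symmetric])

lemma partial_deriv_add:
  "f differentiable (at x) \<Longrightarrow> g differentiable (at x) \<Longrightarrow>
    partial_deriv i (\<lambda>x. f x + g x) x = partial_deriv i f x + partial_deriv i g x"
  unfolding frechet_derivative_works
  by (subst partial_deriv_eq[OF has_derivative_add]) (auto simp: partial_deriv_def)

lemma partial_deriv_diff: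
  "f differentiable (at x) \<Longrightarrow> g differentiable (at x) \<Longrightarrow>
    partial_deriv i (\<lambda>x. f x - g x) x = partial_deriv i f x - partial_deriv i g x"
  unfolding frechet_derivative_works
  by (subst partial_deriv_eq[OF has_derivative_diff]) (auto simp: partial_deriv_def)

lemma partial_deriv_mult:
  "f differentiable (at x) \<Longrightarrow> g differentiable (at x) \<Longrightarrow>
    partial_deriv i (\<lambda>x. f x * g x) x = f x * partial_deriv i g x + partial_deriv i f x * g x"
  unfolding frechet_derivative_works
  by (subst partial_deriv_eq[OF has_derivative_mult]) (auto simp: partial_deriv_def)

lemma partial_deriv_sum:
  "finite I \<Longrightarrow> (\<And>j. j \<in> I \<Longrightarrow> f j differentiable (at x)) \<Longrightarrow>
    partial_deriv i (\<lambda>x. \<Sum>j\<in>I. f j x) x = (\<Sum>j\<in>I. partial_deriv i (f j) x)"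
  unfolding frechet_derivative_works
  by (subst partial_deriv_eq[OF has_derivative_sum]) (auto simp: partial_deriv_def)

section \<open>Left translation invariance on $C^2$ functions\<close>

lemma Ck_on_2_frechet: "Ck_on 2 UNIV f \<Longrightarrow> Ck_on 1 UNIV (\<lambda>x. frechet_derivative f (at x) v)"
  unfolding numeral_2_eq_2 One_nat_def by (rule Ck_on_frechet)

lemma Ck_on_1_has_derivative:
  "Ck_on 1 UNIV f \<Longrightarrow> (f has_derivative frechet_derivative f (at x)) (at x)"
  unfolding One_nat_def by (rule Ck_on_has_derivative)

lemma Ck_on_2_imp_1: "Ck_on 2 S f \<Longrightarrow> Ck_on 1 S f"
  by (erule Ck_on_mono) simp

lemma Ck_on_1_differentiable: "Ck_on 1 UNIV f \<Longrightarrow> f differentiable (at x)"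
  by simp

lemma Ck_on_2_partial: "Ck_on 2 UNIV f \<Longrightarrow> Ck_on 1 UNIV (partial_deriv i f)"
  unfolding partial_deriv_def[abs_def] by (rule Ck_on_2_frechet)

lemma Ck_on_1_partial: "Ck_on 1 UNIV f \<Longrightarrow> continuous_on UNIV (partial_deriv i f)"
  unfolding partial_deriv_def[abs_def] by simp

lemma gradient_add:
  "f differentiable (at x) \<Longrightarrow> g differentiable (at x) \<Longrightarrow>
    gradient (\<lambda>x. f x + g x) x = gradient f x + gradient g x"
  by (simp add: gradient_def vec_eq_iff partial_deriv_add)

lemma Ck_on_flux:
  assumes "\<And>i j. Ck_on 1 UNIV (\<lambda>x. A x $ i $ j)" and "Ck_on 2 UNIV w"
  shows "Ck_on 1 UNIV (\<lambda>y. (A y *v gradient w y) $ i)"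
  unfolding matrix_vector_mult_def gradient_def vec_lambda_beta
  by (intro Ck_on_sum Ck_on_mult assms Ck_on_2_partial)

lemma diff_op_add:
  assumes A: "\<And>i j. Ck_on 1 UNIV (\<lambda>x. A x $ i $ j)"
    and f: "Ck_on 2 UNIV f" and g: "Ck_on 2 UNIV g"
  shows "diff_op A b (\<lambda>x. f x + g x) x = diff_op A b f x + diff_op A b g x"
proof -
  have "gradient (\<lambda>x. f x + g x) y = gradient f y + gradient g y" for y
    using f g by (intro gradient_add Ck_on_1_differentiable Ck_on_2_imp_1)
  then show ?thesis
    unfolding diff_op_def divergence_def
    by (simp add: matrix_vector_right_distrib inner_add_right partial_deriv_add
        Ck_on_1_differentiable[OF Ck_on_flux[OF A f]] Ck_on_1_differentiable[OF Ck_on_flux[OF A g]]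
        sum.distrib)
qed

section \<open>Second derivatives, flat functions and second-order jets\<close>

definition second_deriv :: "('a::real_normed_vector \<Rightarrow> real) \<Rightarrow> 'a \<Rightarrow> 'a \<Rightarrow> 'a \<Rightarrow> real" where
  "second_deriv f x v w = frechet_derivative (\<lambda>y. frechet_derivative f (at y) w) (at x) v"

lemma second_deriv_eq:
  "(\<And>y. frechet_derivative f (at y) w = f' y) \<Longrightarrow> (f' has_derivative f'') (at x) \<Longrightarrow>
    second_deriv f x v w = f'' v"
  by (simp add: second_deriv_def frechet_derivative_at[symmetric])

text \<open>Linearity in the last argument comes from linearity of the first derivative at every
  point, differentiated once more; linearity in the other argument is that of a Frechet
  derivative.\<close>

lemma bilinear_second_deriv:
  assumes f: "Ck_on 2 UNIV f"
  shows "bilinear (second_deriv f x)"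
proof -
  note d = Ck_on_1_has_derivative[OF Ck_on_2_frechet[OF f]]
  have l: "linear (frechet_derivative f (at y))" for y
    by (rule has_derivative_linear[OF Ck_on_1_has_derivative[OF Ck_on_2_imp_1[OF f]]])
  have "second_deriv f x v (w + w') = second_deriv f x v w + second_deriv f x v w'" for v w w'
    by (subst second_deriv_eq[OF linear_add[OF l] has_derivative_add[OF d d]])
      (simp add: second_deriv_def)
  moreover have "second_deriv f x v (c *\<^sub>R w) = c *\<^sub>R second_deriv f x v w" for v c w
    by (subst second_deriv_eq[OF linear_scale[OF l] has_derivative_scaleR_right[OF d]])
      (simp add: second_deriv_def)
  moreover have "linear (\<lambda>v. second_deriv f x v w)" for w
    unfolding second_deriv_def by (rule has_derivative_linear[OF d])
  ultimately show ?thesis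
    unfolding bilinear_def by (auto intro!: linearI)
qed

text \<open>The Hessian need only be skew, which spares us the symmetry of second derivatives:
  a skew form is annihilated by the symmetric principal part of the operator.\<close>

definition flat_at :: "('a::real_normed_vector \<Rightarrow> real) \<Rightarrow> 'a \<Rightarrow> bool" where
  "flat_at r z \<longleftrightarrow> (\<forall>v. frechet_derivative r (at z) v = 0) \<and>
     (\<forall>v w. second_deriv r z v w = - second_deriv r z w v)"

text \<open>In the second derivative of a composite, the second derivatives of \<open>g\<close> are
  paired with the first derivative of \<open>r\<close> at \<open>g x\<close>, which is zero. What is
  left is the pullback of the Hessian of \<open>r\<close> along the derivative of \<open>g\<close>,
  and a pullback of a skew form is skew.\<close>

lemma flat_at_compose:
  fixes g :: "'a::real_normed_vector \<Rightarrow> 'b::euclidean_space"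
  assumes r: "Ck_on 2 UNIV r" and g: "Ck_on 2 UNIV g" and flat: "flat_at r (g x)"
  shows "flat_at (\<lambda>y. r (g y)) x"
proof -
  let ?g' = "\<lambda>y. frechet_derivative g (at y)" and ?r' = "\<lambda>y. frechet_derivative r (at y)"
  note dr = Ck_on_1_has_derivative[OF Ck_on_2_imp_1[OF r]]
    and dg = Ck_on_1_has_derivative[OF Ck_on_2_imp_1[OF g]]
    and ddr = Ck_on_1_has_derivative[OF Ck_on_2_frechet[OF r]]
    and ddg = Ck_on_1_has_derivative[OF Ck_on_2_frechet[OF g]]
  have rg: "frechet_derivative (\<lambda>y. r (g y)) (at y) w = ?r' (g y) (?g' y w)" for y w
    using frechet_derivative_at[OF has_derivative_compose[OF dg dr]] by metis
  have rg': "frechet_derivative (\<lambda>y. r (g y)) (at y) w = (\<Sum>e\<in>Basis. (?g' y w \<bullet> e) * ?r' (g y) e)" for y w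
    unfolding rg by (subst has_derivative_expand_Basis[OF dr]) simp
  have r0: "?r' (g x) v = 0" for v using flat by (simp add: flat_at_def)
  have l: "linear (second_deriv r (g x) v)" for v
    using bilinear_second_deriv[OF r] by (simp add: bilinear_def)
  have dd: "second_deriv (\<lambda>y. r (g y)) x v w = second_deriv r (g x) (?g' x v) (?g' x w)" for v w
  proof -
    have "second_deriv (\<lambda>y. r (g y)) x v w =
        (\<Sum>e\<in>Basis. (?g' x w \<bullet> e) * second_deriv r (g x) (?g' x v) e)"
    proof (rule second_deriv_eq[OF rg'])
      show "((\<lambda>y. \<Sum>e\<in>Basis. (?g' y w \<bullet> e) * ?r' (g y) e) has_derivative
          (\<lambda>v. \<Sum>e\<in>Basis. (?g' x w \<bullet> e) * second_deriv r (g x) (?g' x v) e)) (at x)"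
        unfolding second_deriv_def
        by (rule has_derivative_eq_rhs[OF has_derivative_sum[OF has_derivative_mult[OF
            bounded_linear.has_derivative[OF bounded_linear_inner_left ddg]
            has_derivative_compose[OF dg ddr]]]])
          (simp add: r0)
    qed
    also have "\<dots> = second_deriv r (g x) (?g' x v) (\<Sum>e\<in>Basis. (?g' x w \<bullet> e) *\<^sub>R e)"
      by (simp add: linear_sum[OF l] linear_scale[OF l])
    finally show ?thesis by (simp add: euclidean_representation)
  qed
  show ?thesis using flat unfolding flat_at_def rg dd by blast
qed

text \<open>The vanishing gradient removes the drift and every term with a derivative of
  \<open>A\<close>. What remains is the contraction of the symmetric matrix \<open>A z\<close> with
  a skew form, which equals its own negative.\<close>

lemma diff_op_flat_at:
  assumes A: "\<And>i j. Ck_on 1 UNIV (\<lambda>x. A x $ i $ j)" and sym: "\<And>x. transpose (A x) = A x"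
    and r: "Ck_on 2 UNIV r" and flat: "flat_at r z"
  shows "diff_op A b r z = 0"
proof -
  let ?H = "\<lambda>i j. second_deriv r z (axis i 1) (axis j 1)"
  have p0: "partial_deriv i r z = 0" for i
    using flat by (simp add: partial_deriv_def flat_at_def)
  have pp: "partial_deriv i (partial_deriv j r) z = ?H i j" for i j
    by (simp add: partial_deriv_def[abs_def] second_deriv_def)
  have g0: "gradient r z = 0" by (simp add: gradient_def vec_eq_iff p0)
  have "partial_deriv i (\<lambda>y. (A y *v gradient r y) $ i) z = (\<Sum>j\<in>UNIV. A z $ i $ j * ?H i j)" for i
  proof -
    have "partial_deriv i (\<lambda>y. \<Sum>j\<in>UNIV. A y $ i $ j * partial_deriv j r y) z =
        (\<Sum>j\<in>UNIV. partial_deriv i (\<lambda>y. A y $ i $ j * partial_deriv j r y) z)"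
      by (intro partial_deriv_sum Ck_on_1_differentiable Ck_on_mult A Ck_on_2_partial r) simp
    also have "\<dots> = (\<Sum>j\<in>UNIV. A z $ i $ j * ?H i j)"
      by (subst partial_deriv_mult)
        (simp_all only: Ck_on_1_differentiable[OF A] Ck_on_1_differentiable[OF Ck_on_2_partial[OF r]]
          p0 pp mult_zero_right add_0_right)
    finally show ?thesis
      by (simp add: matrix_vector_mult_def gradient_def)
  qed
  then have "diff_op A b r z = (\<Sum>i\<in>UNIV. \<Sum>j\<in>UNIV. A z $ i $ j * ?H i j)" (is "_ = ?S")
    by (simp add: diff_op_def g0 divergence_def)
  also have "?S = 0"
  proof -
    have "(\<Sum>i\<in>UNIV. \<Sum>j\<in>UNIV. A z $ i $ j * ?H i j) =
        (\<Sum>j\<in>UNIV. \<Sum>i\<in>UNIV. A z $ i $ j * ?H i j)" by (rule sum.swap)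
    also have "\<dots> = (\<Sum>j\<in>UNIV. \<Sum>i\<in>UNIV. - (A z $ j $ i * ?H j i))"
    proof (intro sum.cong refl)
      fix i j
      have "transpose (A z) $ j $ i = A z $ i $ j" by (simp add: transpose_def)
      then have "A z $ i $ j = A z $ j $ i" by (simp only: sym)
      moreover have "?H i j = - ?H j i" using flat unfolding flat_at_def by blast
      ultimately show "A z $ i $ j * ?H i j = - (A z $ j $ i * ?H j i)" by simp
    qed
    also have "\<dots> = - ?S" by (simp add: sum_negf)
    finally show ?thesis by simp
  qed
  finally show ?thesis .
qed

text \<open>The witness is the second-order Taylor polynomial at \<open>z\<close> without its
  constant term, which \<open>flat_at\<close> does not see. A quadratic form records only the
  symmetric part of the Hessian, so subtracting it leaves the skew part.\<close>

lemma smooth_jet: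
  fixes f :: "'a::euclidean_space \<Rightarrow> real"
  assumes f: "Ck_on 2 UNIV f"
  obtains p where "smooth_on UNIV p" "flat_at (\<lambda>y. f y - p y) z"
proof -
  let ?D = "frechet_derivative f (at z)" and ?Q = "second_deriv f z"
  define p where "p y = ?D (y - z) + ?Q (y - z) (y - z) / 2" for y
  define p' where "p' w y = ?D w + (?Q (y - z) w + ?Q w (y - z)) / 2" for w y
  have bQ: "bounded_bilinear ?Q"
    using bilinear_second_deriv[OF f] by (simp add: bilinear_conv_bounded_bilinear)
  have bD: "bounded_linear ?D"
    by (rule has_derivative_bounded_linear[OF Ck_on_1_has_derivative[OF Ck_on_2_imp_1[OF f]]])
  have idm: "((\<lambda>y. y - z) has_derivative (\<lambda>v. v)) (at y)" for y
    by (auto intro!: derivative_eq_intros)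
  have bl: "bounded_linear (\<lambda>y. (?Q y w + ?Q w y) / 2)" for w
    using bounded_linear_scaleR_right[THEN bounded_linear_compose, OF bounded_linear_add[OF
          bounded_bilinear.bounded_linear_left[OF bQ] bounded_bilinear.bounded_linear_right[OF bQ]], of "1/2" w w]
    by simp
  have p: "(p has_derivative (\<lambda>w. p' w y)) (at y)" for y
    unfolding p_def[abs_def] p'_def
    using has_derivative_add[OF bounded_linear.has_derivative[OF bD idm]
        has_derivative_scaleR_right[OF bounded_bilinear.FDERIV[OF bQ idm idm], of "1/2"]]
    by simp
  \<comment> \<open>Collecting the terms in \<open>z\<close> exhibits the derivative of
    \<open>p\<close> as an affine function of \<open>y\<close>, so \<open>p\<close> is of every
    class.\<close>
  have p'eq: "p' w = (\<lambda>y. (?D w - (?Q z w + ?Q w z) / 2) + (?Q y w + ?Q w y) / 2)" for w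
    by (simp add: p'_def fun_eq_iff bounded_bilinear.diff_left[OF bQ] bounded_bilinear.diff_right[OF bQ]
        add_divide_distrib diff_divide_distrib)
  have "Ck_on k UNIV p" for k
  proof -
    have "Ck_on (Suc k) UNIV p"
      by (rule Ck_on_SucI[OF p]) (unfold p'eq, rule Ck_on_affine[OF bl])
    then show ?thesis by (rule Ck_on_Suc_imp)
  qed
  then have "smooth_on UNIV p" by (simp add: smooth_on_def)
  moreover have "flat_at (\<lambda>y. f y - p y) z"
  proof -
    have d: "frechet_derivative (\<lambda>y. f y - p y) (at y) v = frechet_derivative f (at y) v - p' v y" for y v
      using frechet_derivative_at[OF has_derivative_diff[OF Ck_on_1_has_derivative[OF Ck_on_2_imp_1[OF f]] p]]
      by metis
    have p'': "(p' w has_derivative (\<lambda>v. (?Q v w + ?Q w v) / 2)) (at y)" for w y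
      unfolding p'eq
      using has_derivative_add[OF has_derivative_const bounded_linear.has_derivative[OF bl has_derivative_ident]]
      by simp
    have "second_deriv (\<lambda>y. f y - p y) z v w = (?Q v w - ?Q w v) / 2" for v w
      by (subst second_deriv_eq[OF d has_derivative_diff[OF Ck_on_1_has_derivative[OF Ck_on_2_frechet[OF f]] p'']])
        (simp add: second_deriv_def diff_divide_distrib add_divide_distrib)
    moreover have "frechet_derivative (\<lambda>y. f y - p y) (at z) v = 0" for v
      by (simp add: d p'_def bounded_bilinear.zero_left[OF bQ] bounded_bilinear.zero_right[OF bQ])
    ultimately show ?thesis unfolding flat_at_def
      by (simp only: minus_divide_left minus_diff_eq simp_thms)
  qed
  ultimately show thesis by (rule that)
qed

text \<open>Invariance is given for smooth functions but must be applied to one that is only C^2. At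
  a single point a second-order operator sees just a 2-jet, so \<open>w\<close> is split into a
  smooth jet at \<open>m \<alpha> x\<close> and a flat remainder. The remainder contributes zero on
  both sides, because flatness survives composition with the translation.\<close>

lemma left_translation_invariant_C2:
  assumes A: "\<And>i j. Ck_on 1 UNIV (\<lambda>x. A x $ i $ j)" and sym: "\<And>x. transpose (A x) = A x"
    and inv: "left_translation_invariant m (diff_op A b)"
    and m: "Ck_on 2 UNIV (m \<alpha>)" and w: "Ck_on 2 UNIV w"
  shows "diff_op A b (\<lambda>y. w (m \<alpha> y)) x = diff_op A b w (m \<alpha> x)"
proof -
  obtain p where p: "smooth_on UNIV p" and flat: "flat_at (\<lambda>y. w y - p y) (m \<alpha> x)"
    using smooth_jet[OF w] by blast
  have p2: "Ck_on 2 UNIV p" using p by (simp add: smooth_on_def)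
  let ?r = "\<lambda>y. w y - p y"
  have r2: "Ck_on 2 UNIV ?r" by (rule Ck_on_diff[OF w p2])
  have "diff_op A b (\<lambda>y. p (m \<alpha> y) + ?r (m \<alpha> y)) x =
      diff_op A b (\<lambda>y. p (m \<alpha> y)) x + diff_op A b (\<lambda>y. ?r (m \<alpha> y)) x"
    by (rule diff_op_add[OF A Ck_on_compose[OF p2 m] Ck_on_compose[OF r2 m]])
  also have "\<dots> = diff_op A b p (m \<alpha> x)"
    using inv p diff_op_flat_at[OF A sym Ck_on_compose[OF r2 m] flat_at_compose[OF r2 m flat]]
    by (simp add: left_translation_invariant_def)
  also have "\<dots> = diff_op A b p (m \<alpha> x) + diff_op A b ?r (m \<alpha> x)"
    using diff_op_flat_at[OF A sym r2 flat] by simp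
  also have "\<dots> = diff_op A b (\<lambda>y. p y + ?r y) (m \<alpha> x)"
    by (rule diff_op_add[OF A p2 r2, symmetric])
  finally show ?thesis by simp
qed

section \<open>Green's identity\<close>

definition bounded_support :: "real \<Rightarrow> ('a::real_normed_vector \<Rightarrow> 'b::zero) \<Rightarrow> bool" where
  "bounded_support R g \<longleftrightarrow> (\<forall>x. R < norm x \<longrightarrow> g x = 0)"

lemma bounded_support_mult:
  fixes f g :: "_ \<Rightarrow> real"
  shows "bounded_support R g \<Longrightarrow> bounded_support R (\<lambda>x. f x * g x)"
  by (simp add: bounded_support_def)

lemma integrable_bounded_support:
  fixes g :: "'a::euclidean_space \<Rightarrow> real"
  assumes "continuous_on UNIV g" "bounded_support R g"
  shows "integrable lborel g"
proof -
  have "integrable lborel (\<lambda>x. indicator (cball 0 R) x *\<^sub>R g x)"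
    by (rule borel_integrable_compact) (auto intro: continuous_on_subset[OF assms(1)])
  also have "(\<lambda>x. indicator (cball 0 R) x *\<^sub>R g x) = g"
    using assms(2) by (auto simp: bounded_support_def fun_eq_iff indicator_def not_le)
  finally show ?thesis .
qed

lemma bounded_bounded_support:
  fixes g :: "'a::euclidean_space \<Rightarrow> real"
  assumes "continuous_on UNIV g" "bounded_support R g"
  obtains M where "\<And>x. \<bar>g x\<bar> \<le> M"
proof -
  have "bounded (g ` cball 0 R)"
    by (intro compact_imp_bounded compact_continuous_image continuous_on_subset[OF assms(1)]) auto
  then obtain M where "\<forall>y\<in>g ` cball 0 R. norm y \<le> M" unfolding bounded_iff by blast
  then have M: "\<And>x. x \<in> cball 0 R \<Longrightarrow> \<bar>g x\<bar> \<le> M" by auto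
  have "\<bar>g x\<bar> \<le> \<bar>M\<bar>" for x
    using M[of x] assms(2) by (cases "norm x \<le> R") (auto simp: bounded_support_def)
  then show ?thesis by (rule that)
qed

lemma bounded_support_partial_deriv:
  assumes "bounded_support R g"
  shows "bounded_support R (partial_deriv i g)"
  unfolding bounded_support_def
proof (intro allI impI)
  fix x :: "real^'a"
  assume x: "R < norm x"
  have "open {x. R < norm x}" by (intro open_Collect_less continuous_intros)
  then have "(g has_derivative (\<lambda>v. 0)) (at x)"
    by (rule has_derivative_transform_within_open[OF has_derivative_const[of 0]]) (use assms x in \<open>auto simp: bounded_support_def\<close>)
  then show "partial_deriv i g x = 0" by (simp add: partial_deriv_eq)
qed

text \<open>Difference quotients of \<open>g\<close> integrate to zero by translation invariance of
  Lebesgue measure, and dominated convergence carries this over to the partial derivative.\<close>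

lemma integral_partial_deriv_eq_0:
  fixes g :: "real^'n::finite \<Rightarrow> real"
  assumes g: "Ck_on 1 UNIV g" and supp: "bounded_support R g"
  shows "(\<integral>x. partial_deriv i g x \<partial>lborel) = 0"
proof -
  let ?e = "axis i 1 :: real^'n"
  have cg: "continuous_on UNIV g" using g by (rule Ck_on_imp_continuous)
  have cp: "continuous_on UNIV (partial_deriv i g)" using g by (rule Ck_on_1_partial)
  obtain M where M: "\<And>x. \<bar>partial_deriv i g x\<bar> \<le> M"
    using bounded_bounded_support[OF cp bounded_support_partial_deriv[OF supp]] by blast
  have ig: "integrable lborel g" by (rule integrable_bounded_support[OF cg supp])
  have D: "((\<lambda>t. g (x + t *\<^sub>R ?e)) has_real_derivative partial_deriv i g (x + t *\<^sub>R ?e)) (at t)" for x t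
  proof -
    have "((\<lambda>t. x + t *\<^sub>R ?e) has_derivative (\<lambda>s. s *\<^sub>R ?e)) (at t)"
      by (auto intro!: derivative_eq_intros)
    from has_derivative_compose[OF this Ck_on_1_has_derivative[OF g]]
    show ?thesis
      unfolding has_field_derivative_def
      by (rule has_derivative_eq_rhs)
        (simp add: fun_eq_iff partial_deriv_def
          linear_scale[OF has_derivative_linear[OF Ck_on_1_has_derivative[OF g]]])
  qed
  define s where "s n x = (g (x + inverse (real (Suc n)) *\<^sub>R ?e) - g x) * real (Suc n)" for n x
  have shift: "integrable lborel (\<lambda>x. g (x + c))" "(\<integral>x. g (x + c) \<partial>lborel) = (\<integral>x. g x \<partial>lborel)" for c
  proof -
    have m: "(+) c \<in> measurable lborel borel" "g \<in> borel_measurable borel"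
      using cg by (auto intro: borel_measurable_continuous_onI)
    show "integrable lborel (\<lambda>x. g (x + c))"
      using integrable_distr_eq[OF m] ig by (simp add: lborel_distr_plus add.commute)
    show "(\<integral>x. g (x + c) \<partial>lborel) = (\<integral>x. g x \<partial>lborel)"
      using integral_distr[OF m] by (simp add: lborel_distr_plus add.commute)
  qed
  have s0: "(\<integral>x. s n x \<partial>lborel) = 0" for n
    using shift ig by (simp add: s_def)
  have "(\<lambda>n. \<integral>x. s n x \<partial>lborel) \<longlonglongrightarrow> (\<integral>x. partial_deriv i g x \<partial>lborel)"
  proof (rule integral_dominated_convergence)
    show "partial_deriv i g \<in> borel_measurable lborel"
      using cp by (auto intro: borel_measurable_continuous_onI)
    show "s n \<in> borel_measurable lborel" for n
      unfolding s_def[abs_def]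
      by (auto intro!: borel_measurable_continuous_onI continuous_intros continuous_on_compose2[OF cg])
    \<comment> \<open>The increments are at most 1, so beyond radius \<open>R + 1\<close> both
      points of the difference quotient lie outside the support. Within that radius the mean value
      theorem bounds the quotient by \<open>M\<close>.\<close>
    show "integrable lborel (\<lambda>x. M * indicator (cball 0 (R + 1)) x)"
      by (auto intro!: integrable_mult_right emeasure_compact_finite integrable_real_indicator)
    show "AE x in lborel. (\<lambda>n. s n x) \<longlonglongrightarrow> partial_deriv i g x"
    proof (rule AE_I2)
      fix x
      have "((\<lambda>h. (g (x + h *\<^sub>R ?e) - g x) / h) \<longlongrightarrow> partial_deriv i g x) (at 0)"
        using D[of x 0] by (simp add: DERIV_def)
      moreover have "filterlim (\<lambda>n. inverse (real (Suc n))) (at 0) sequentially"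
        unfolding filterlim_at using LIMSEQ_inverse_real_of_nat by auto
      ultimately have "(\<lambda>n. (g (x + inverse (real (Suc n)) *\<^sub>R ?e) - g x) / inverse (real (Suc n)))
          \<longlonglongrightarrow> partial_deriv i g x"
        by (rule filterlim_compose)
      then show "(\<lambda>n. s n x) \<longlonglongrightarrow> partial_deriv i g x" by (simp add: s_def[abs_def] divide_inverse)
    qed
    show "AE x in lborel. norm (s n x) \<le> M * indicator (cball 0 (R + 1)) x" for n
    proof (rule AE_I2)
      fix x
      let ?h = "inverse (real (Suc n))"
      have h: "0 < ?h" "?h \<le> 1" by (auto simp: field_simps)
      show "norm (s n x) \<le> M * indicator (cball 0 (R + 1)) x"
      proof (cases "norm x \<le> R + 1")
        case True
        obtain t where t: "g (x + ?h *\<^sub>R ?e) - g (x + 0 *\<^sub>R ?e) = (?h - 0) * partial_deriv i g (x + t *\<^sub>R ?e)"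
          using MVT2[OF h(1) D] by blast
        then have "s n x = partial_deriv i g (x + t *\<^sub>R ?e)" by (simp add: s_def)
        then show ?thesis using M True by simp
      next
        case False
        have "norm x - norm (?h *\<^sub>R ?e) \<le> norm (x + ?h *\<^sub>R ?e)"
          using norm_triangle_ineq4[of "x + ?h *\<^sub>R ?e" "?h *\<^sub>R ?e"] by simp
        then have "R < norm (x + ?h *\<^sub>R ?e)" "R < norm x" using False h by auto
        then show ?thesis using False supp by (simp add: s_def bounded_support_def)
      qed
    qed
  qed
  then show ?thesis by (simp add: s0 LIMSEQ_const_iff)
qed

text \<open>The formal adjoint of \<open>diff_op A b\<close> for symmetric \<open>A\<close>. Writing
  it as one divergence makes its integral vanish at once when \<open>w\<close> has bounded
  support.\<close>

definition adjoint_op ::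
  "(real^'n::finite \<Rightarrow> real^'n^'n) \<Rightarrow> (real^'n \<Rightarrow> real^'n) \<Rightarrow> (real^'n \<Rightarrow> real) \<Rightarrow> real^'n \<Rightarrow> real" where
  "adjoint_op A b w x = divergence (\<lambda>y. A y *v gradient w y - w y *\<^sub>R b y) x"

locale diff_operator =
  fixes A :: "real^'n::finite \<Rightarrow> real^'n^'n" and b :: "real^'n \<Rightarrow> real^'n"
  assumes A: "\<And>i j. Ck_on 1 UNIV (\<lambda>x. A x $ i $ j)"
    and b: "\<And>i. Ck_on 1 UNIV (\<lambda>x. b x $ i)"
    and sym: "\<And>x. transpose (A x) = A x"
begin

lemma flux_symmetric: "(A x *v v) \<bullet> w = (A x *v w) \<bullet> v"
  by (metis dot_lmul_matrix inner_commute sym transpose_matrix_vector)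

lemma Ck_on_adjoint_flux:
  "Ck_on 2 UNIV w \<Longrightarrow> Ck_on 1 UNIV (\<lambda>y. (A y *v gradient w y - w y *\<^sub>R b y) $ i)"
  unfolding vector_minus_component vector_scaleR_component real_scaleR_def
  by (intro Ck_on_diff Ck_on_flux Ck_on_mult A b Ck_on_2_imp_1)

lemma continuous_on_diff_op:
  assumes "Ck_on 2 UNIV w" shows "continuous_on UNIV (diff_op A b w)"
proof -
  have "continuous_on UNIV (\<lambda>x. b x $ i * partial_deriv i w x)" for i
    by (intro continuous_intros Ck_on_1_partial Ck_on_2_imp_1 assms Ck_on_imp_continuous[OF b])
  then show ?thesis
    unfolding diff_op_def[abs_def] divergence_def inner_vec_def inner_real_def gradient_def vec_lambda_beta
    using Ck_on_1_partial[OF Ck_on_flux[OF A assms]]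
    by (intro continuous_on_add continuous_on_sum) (auto simp: gradient_def)
qed

lemma continuous_on_adjoint_op: "Ck_on 2 UNIV w \<Longrightarrow> continuous_on UNIV (adjoint_op A b w)"
  unfolding adjoint_op_def[abs_def] divergence_def
  by (intro continuous_on_sum Ck_on_1_partial Ck_on_adjoint_flux)

lemma bounded_support_adjoint_flux:
  assumes "bounded_support R w"
  shows "bounded_support R (\<lambda>x. (A x *v gradient w x - w x *\<^sub>R b x) $ i)"
  unfolding bounded_support_def
proof (intro allI impI)
  fix x :: "real^'n" assume x: "R < norm x"
  have "gradient w x = 0"
    using bounded_support_partial_deriv[OF assms] x
    by (simp add: bounded_support_def gradient_def vec_eq_iff)
  moreover have "w x = 0" using assms x by (simp add: bounded_support_def)
  ultimately show "(A x *v gradient w x - w x *\<^sub>R b x) $ i = 0" by simp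
qed

lemma bounded_support_adjoint_op:
  "bounded_support R w \<Longrightarrow> bounded_support R (adjoint_op A b w)"
  using bounded_support_partial_deriv[OF bounded_support_adjoint_flux]
  unfolding adjoint_op_def[abs_def] divergence_def bounded_support_def
  by (simp del: vector_minus_component vector_scaleR_component)

lemma integral_adjoint_op:
  assumes "Ck_on 2 UNIV w" "bounded_support R w"
  shows "(\<integral>x. adjoint_op A b w x \<partial>lborel) = 0"
proof -
  let ?W = "\<lambda>i y. (A y *v gradient w y - w y *\<^sub>R b y) $ i"
  have supp: "bounded_support R (?W i)" for i
    by (rule bounded_support_adjoint_flux[OF assms(2)])
  have "integrable lborel (partial_deriv i (?W i))" for i
    by (rule integrable_bounded_support[OF Ck_on_1_partial[OF Ck_on_adjoint_flux[OF assms(1)]]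
          bounded_support_partial_deriv[OF supp]])
  then have "(\<integral>x. adjoint_op A b w x \<partial>lborel) = (\<Sum>i\<in>UNIV. \<integral>x. partial_deriv i (?W i) x \<partial>lborel)"
    unfolding adjoint_op_def divergence_def by (intro Bochner_Integration.integral_sum) auto
  also have "\<dots> = 0"
    by (intro sum.neutral ballI integral_partial_deriv_eq_0[OF Ck_on_adjoint_flux[OF assms(1)] supp])
  finally show ?thesis .
qed

text \<open>The difference of the two integrands is the divergence of the field \<open>?U\<close>,
  which has bounded support, so its integral is zero. Symmetry of \<open>A\<close> cancels the
  products of the two gradients, and the \<open>b\<close> part of \<open>?W\<close> supplies the
  drift term.\<close>

lemma green_identity:
  assumes v: "Ck_on 2 UNIV v" and w: "Ck_on 2 UNIV w" and supp: "bounded_support R w"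
  shows "(\<integral>x. diff_op A b v x * w x \<partial>lborel) = (\<integral>x. v x * adjoint_op A b w x \<partial>lborel)"
proof -
  let ?V = "\<lambda>i y. (A y *v gradient v y) $ i"
  let ?W = "\<lambda>i y. (A y *v gradient w y - w y *\<^sub>R b y) $ i"
  let ?U = "\<lambda>i y. w y * ?V i y - v y * ?W i y"
  note V = Ck_on_flux[OF A v] and W = Ck_on_adjoint_flux[OF w]
  note v1 = Ck_on_2_imp_1[OF v] and w1 = Ck_on_2_imp_1[OF w]
  note c = Ck_on_1_differentiable
  have U: "Ck_on 1 UNIV (?U i)" for i
    by (intro Ck_on_diff Ck_on_mult v1 w1 V W)
  have U0: "bounded_support R (?U i)" for i
    using bounded_support_mult[OF bounded_support_adjoint_flux[OF supp], of v i] supp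
    by (simp add: bounded_support_def)
  have pU: "partial_deriv i (?U i) x = w x * partial_deriv i (?V i) x + partial_deriv i w x * ?V i x
      - (v x * partial_deriv i (?W i) x + partial_deriv i v x * ?W i x)" for i x
    using c[OF V] c[OF W] c[OF v1] c[OF w1]
    by (simp only: partial_deriv_diff[OF differentiable_mult differentiable_mult] partial_deriv_mult)
  have pw: "diff_op A b v x * w x - v x * adjoint_op A b w x = (\<Sum>i\<in>UNIV. partial_deriv i (?U i) x)" for x
  proof -
    have "(\<Sum>i\<in>UNIV. partial_deriv i (?U i) x) =
        w x * divergence (\<lambda>y. A y *v gradient v y) x + gradient w x \<bullet> (A x *v gradient v x)
        - (v x * adjoint_op A b w x + gradient v x \<bullet> (A x *v gradient w x - w x *\<^sub>R b x))"
      unfolding pU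
      by (simp only: sum.distrib sum_subtractf sum_distrib_left adjoint_op_def divergence_def
          inner_vec_def inner_real_def gradient_def vec_lambda_beta)
    then show ?thesis
      using flux_symmetric[of x "gradient v x" "gradient w x"]
      by (simp add: diff_op_def inner_diff_right inner_commute algebra_simps)
  qed
  have i1: "integrable lborel (\<lambda>x. diff_op A b v x * w x)"
    by (rule integrable_bounded_support[OF continuous_on_mult[OF continuous_on_diff_op[OF v]
            Ck_on_imp_continuous[OF w]] bounded_support_mult[OF supp]])
  have i2: "integrable lborel (\<lambda>x. v x * adjoint_op A b w x)"
    by (rule integrable_bounded_support[OF continuous_on_mult[OF Ck_on_imp_continuous[OF v]
            continuous_on_adjoint_op[OF w]] bounded_support_mult[OF bounded_support_adjoint_op[OF supp]]])
  have "integrable lborel (partial_deriv i (?U i))" for i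
    by (rule integrable_bounded_support[OF Ck_on_1_partial[OF U] bounded_support_partial_deriv[OF U0]])
  then have "(\<integral>x. (\<Sum>i\<in>UNIV. partial_deriv i (?U i) x) \<partial>lborel) =
      (\<Sum>i\<in>UNIV. \<integral>x. partial_deriv i (?U i) x \<partial>lborel)"
    by (intro Bochner_Integration.integral_sum) auto
  also have "\<dots> = 0"
    by (intro sum.neutral ballI integral_partial_deriv_eq_0[OF U U0])
  finally show ?thesis
    using Bochner_Integration.integral_diff[OF i1 i2] by (simp add: pw)
qed

end

section \<open>A C^2 bump function\<close>

lemma has_real_derivative_mult_abs: "((\<lambda>x. x * \<bar>x\<bar>) has_real_derivative 2 * \<bar>x\<bar>) (at x)"
proof (cases "x = 0")
  case True
  have "((\<lambda>h. h * \<bar>h\<bar> / h) \<longlongrightarrow> 0) (at (0::real))"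
    by (rule Lim_transform_eventually[of abs]) (auto simp: eventually_at_filter tendsto_eq_intros intro!: tendsto_eq_intros)
  then show ?thesis by (simp add: True DERIV_def)
next
  case False
  then consider "x < 0" | "0 < x" by linarith
  then show ?thesis
  proof cases
    case 1
    show ?thesis
      by (rule has_field_derivative_transform_within_open[of "\<lambda>x. - (x * x)" _ _ "{..<0}"])
        (use 1 in \<open>auto intro!: derivative_eq_intros\<close>)
  next
    case 2
    show ?thesis
      by (rule has_field_derivative_transform_within_open[of "\<lambda>x. x * x" _ _ "{0<..}"])
        (use 2 in \<open>auto intro!: derivative_eq_intros\<close>)
  qed
qed

text \<open>Green's identity asks only for C^2 test functions, so a one-sided cubic power of
  \<open>1 - x \<bullet> x\<close> can serve as the bump. Expressing the positive part through the
  absolute value reduces its regularity to the derivative of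
  \<open>s * \<bar>s\<bar>\<close>.\<close>

lemma C2_bump:
  obtains \<phi> :: "real^'n::finite \<Rightarrow> real" where "Ck_on 2 UNIV \<phi>" "bounded_support 1 \<phi>"
    "\<And>x. 0 \<le> \<phi> x" "0 < \<phi> 0"
proof -
  have ca: "Ck_on 0 UNIV (\<lambda>s::real. 2 * \<bar>s\<bar>)" by (auto intro!: continuous_intros)
  have c1: "Ck_on 1 UNIV (\<lambda>s::real. s * \<bar>s\<bar>)"
    unfolding One_nat_def by (rule Ck_on_Suc_realI[OF has_real_derivative_mult_abs ca])
  have id: "Ck_on k UNIV (\<lambda>s::'a::real_normed_vector. s)" for k
    by (rule Ck_on_bounded_linear[OF bounded_linear_ident])
  \<comment> \<open>\<open>h s = 2 (max 0 s)\<^sup>3\<close>\<close>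
  define h :: "real \<Rightarrow> real" where "h s = s * (s * s) + s * (s * \<bar>s\<bar>)" for s
  have "Ck_on 2 UNIV (\<lambda>s::real. s * (s * \<bar>s\<bar>))"
    unfolding numeral_2_eq_2
  proof (rule Ck_on_Suc_realI)
    show "((\<lambda>s. s * (s * \<bar>s\<bar>)) has_real_derivative 3 * (x * \<bar>x\<bar>)) (at x)" for x :: real
      using DERIV_mult[OF DERIV_ident has_real_derivative_mult_abs, of x] by (simp add: algebra_simps)
    show "Ck_on (Suc 0) UNIV (\<lambda>s::real. 3 * (s * \<bar>s\<bar>))"
      by (intro Ck_on_mult Ck_on_const c1[unfolded One_nat_def])
  qed
  then have h: "Ck_on 2 UNIV h" unfolding h_def[abs_def]
    by (intro Ck_on_add[OF Ck_on_mult[OF id Ck_on_mult[OF id id]]])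
  have h_eq: "h s = s * s * (s + \<bar>s\<bar>)" for s by (simp add: h_def algebra_simps)
  define \<phi> :: "real^'n \<Rightarrow> real" where "\<phi> x = h (1 - x \<bullet> x)" for x
  show thesis
  proof
    show "Ck_on 2 UNIV \<phi>"
      unfolding \<phi>_def[abs_def] inner_vec_def inner_real_def
      by (intro Ck_on_compose_real[OF h] Ck_on_diff Ck_on_const Ck_on_sum Ck_on_mult Ck_on_component id)
    have "\<phi> x = 0" if "1 < norm x" for x
    proof -
      have "1 < norm x * norm x" using that by (simp add: less_1_mult)
      then show ?thesis by (simp add: \<phi>_def h_eq dot_square_norm power2_eq_square)
    qed
    then show "bounded_support 1 \<phi>" by (simp add: bounded_support_def)
    show "0 \<le> \<phi> x" for x by (simp add: \<phi>_def h_eq)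
    show "0 < \<phi> 0" by (simp add: \<phi>_def h_def)
  qed
qed

section \<open>Integrable subharmonic functions\<close>

lemma Lie_group_op_C:
  assumes "Lie_group_op m"
  shows "Ck_on k UNIV (m \<alpha>)" and "continuous_on UNIV (\<lambda>(x, y). m x y)"
proof -
  have m: "Ck_on k UNIV (\<lambda>(x, y). m x y)" for k
    using assms by (auto simp: Lie_group_op_def smooth_on_def)
  have "bounded_linear (\<lambda>y::real^'a. (0::real^'a, y))"
    by (intro bounded_linear_Pair bounded_linear_zero bounded_linear_ident)
  from Ck_on_compose_affine[OF this m, of k "(\<alpha>, 0)"] show "Ck_on k UNIV (m \<alpha>)" by simp
  show "continuous_on UNIV (\<lambda>(x, y). m x y)" using m[of 0] by simp
qed

text \<open>The measure-preserving substitution \<open>x = m \<beta> y\<close> moves the translation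
  from the test function onto \<open>v\<close>. Green's identity then applies to the translated
  \<open>v\<close> and the original \<open>w\<close>, whose support is known to be bounded, and left
  invariance identifies the operator applied to the translated \<open>v\<close>.\<close>

lemma (in diff_operator) integral_left_translate:
  assumes m: "Ck_on 2 UNIV (m \<beta>)" and ba: "\<And>y. m \<alpha> (m \<beta> y) = y"
    and contA: "continuous_on UNIV (m \<alpha>)"
    and inv: "left_translation_invariant m (diff_op A b)"
    and meas: "distr lborel borel (m \<beta>) = lborel"
    and v: "Ck_on 2 UNIV v" and w: "Ck_on 2 UNIV w" and supp: "bounded_support R w"
  shows "integrable lborel (\<lambda>x. diff_op A b v x * w (m \<alpha> x))"
    and "(\<integral>x. diff_op A b v x * w (m \<alpha> x) \<partial>lborel) =
      (\<integral>x. v x * adjoint_op A b w (m \<alpha> x) \<partial>lborel)"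
proof -
  note cw = Ck_on_imp_continuous[OF w] and cL = continuous_on_diff_op[OF v]
  have mb: "m \<beta> \<in> measurable lborel borel"
    using Ck_on_imp_continuous[OF m] by (auto intro: borel_measurable_continuous_onI)
  have sub: "(\<integral>x. h x \<partial>lborel) = (\<integral>y. h (m \<beta> y) \<partial>lborel)"
    if "continuous_on UNIV h" for h :: "real^'n \<Rightarrow> real"
    using integral_distr[OF mb borel_measurable_continuous_onI[OF that]] by (simp add: meas)
  have c1: "continuous_on UNIV (\<lambda>x. diff_op A b v x * w (m \<alpha> x))"
    by (intro continuous_on_mult cL continuous_on_compose2[OF cw contA]) auto
  have c2: "continuous_on UNIV (\<lambda>x. v x * adjoint_op A b w (m \<alpha> x))"
    by (intro continuous_on_mult Ck_on_imp_continuous[OF v]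
        continuous_on_compose2[OF continuous_on_adjoint_op[OF w] contA]) auto
  have Lm: "diff_op A b (\<lambda>y. v (m \<beta> y)) y = diff_op A b v (m \<beta> y)" for y
    by (rule left_translation_invariant_C2[OF A sym inv m v])
  have vm: "Ck_on 2 UNIV (\<lambda>y. v (m \<beta> y))" by (rule Ck_on_compose[OF v m])
  have "integrable lborel (\<lambda>y. diff_op A b (\<lambda>y. v (m \<beta> y)) y * w y)"
    by (rule integrable_bounded_support[OF continuous_on_mult[OF continuous_on_diff_op[OF vm] cw]
          bounded_support_mult[OF supp]])
  then show "integrable lborel (\<lambda>x. diff_op A b v x * w (m \<alpha> x))"
    using integrable_distr_eq[OF mb borel_measurable_continuous_onI[OF c1]] by (simp add: meas ba Lm)
  show "(\<integral>x. diff_op A b v x * w (m \<alpha> x) \<partial>lborel) = (\<integral>x. v x * adjoint_op A b w (m \<alpha> x) \<partial>lborel)"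
    unfolding sub[OF c1] sub[OF c2] ba using green_identity[OF vm w supp] by (simp add: Lm)
qed

theorem (in diff_operator) integrable_subharmonic_imp_harmonic:
  assumes m: "Lie_group_op m"
    and inv: "left_translation_invariant m (diff_op A b)"
    and left: "\<And>\<alpha>. distr lborel borel (\<lambda>x. m \<alpha> x) = lborel"
    and right: "\<And>\<alpha>. distr lborel borel (\<lambda>x. m x \<alpha>) = lborel"
    and v: "Ck_on 2 UNIV v" and int: "integrable lborel v"
    and sub: "\<And>x. 0 \<le> diff_op A b v x"
  shows "diff_op A b v z = 0"
proof -
  obtain e inver where grp: "group m e inver" using m by (auto simp: Lie_group_op_def)
  interpret G: group m e inver by (rule grp)
  obtain \<phi> :: "real^'n \<Rightarrow> real" where \<phi>: "Ck_on 2 UNIV \<phi>" "bounded_support 1 \<phi>"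
    and \<phi>0: "\<And>x. 0 \<le> \<phi> x" "0 < \<phi> 0"
    using C2_bump by blast
  note cm = Lie_group_op_C(2)[OF m]
  have cml: "continuous_on UNIV (m \<alpha>)" for \<alpha>
    using Ck_on_imp_continuous[OF Lie_group_op_C(1)[OF m, of 0]] .
  have cmr: "continuous_on UNIV (\<lambda>\<alpha>. m \<alpha> x)" for x
    using continuous_on_compose2[OF cm continuous_on_Pair[OF continuous_on_id continuous_on_const]]
    by simp
  let ?\<psi> = "adjoint_op A b \<phi>"
  note c\<psi> = continuous_on_adjoint_op[OF \<phi>(1)]
  have i\<psi>: "integrable lborel ?\<psi>"
    by (rule integrable_bounded_support[OF c\<psi> bounded_support_adjoint_op[OF \<phi>(2)]])
  have mr: "(\<lambda>\<alpha>. m \<alpha> x) \<in> measurable lborel borel" for x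
    using cmr by (auto intro: borel_measurable_continuous_onI)
  \<comment> \<open>Here \<open>x\<close> is fixed and \<open>\<alpha>\<close> varies, so a right
    translation is at work. Right invariance reduces all three claims to \<open>?\<psi>\<close>
    itself, whose integral is zero because it is a divergence.\<close>
  have tr: "integrable lborel (\<lambda>\<alpha>. ?\<psi> (m \<alpha> x))" "(\<integral>\<alpha>. ?\<psi> (m \<alpha> x) \<partial>lborel) = 0"
    "(\<integral>\<alpha>. \<bar>?\<psi> (m \<alpha> x)\<bar> \<partial>lborel) = (\<integral>\<alpha>. \<bar>?\<psi> \<alpha>\<bar> \<partial>lborel)" for x
  proof -
    have p: "?\<psi> \<in> borel_measurable borel" by (rule borel_measurable_continuous_onI[OF c\<psi>])
    show "integrable lborel (\<lambda>\<alpha>. ?\<psi> (m \<alpha> x))"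
      using integrable_distr_eq[OF mr p] i\<psi> by (simp add: right)
    show "(\<integral>\<alpha>. ?\<psi> (m \<alpha> x) \<partial>lborel) = 0"
      using integral_distr[OF mr p] integral_adjoint_op[OF \<phi>] by (simp add: right)
    have "(\<lambda>\<alpha>. \<bar>?\<psi> \<alpha>\<bar>) \<in> borel_measurable borel" using p by simp
    from integral_distr[OF mr this]
    show "(\<integral>\<alpha>. \<bar>?\<psi> (m \<alpha> x)\<bar> \<partial>lborel) = (\<integral>\<alpha>. \<bar>?\<psi> \<alpha>\<bar> \<partial>lborel)" by (simp add: right)
  qed
  let ?K = "\<lambda>x \<alpha>. v x * ?\<psi> (m \<alpha> x)"
  \<comment> \<open>By \<open>tr\<close> the integral of the absolute value over
    \<open>\<alpha>\<close> is \<open>\<bar>v x\<bar>\<close> times a constant independent of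
    \<open>x\<close>, so integrability of \<open>v\<close> gives integrability on the
    product.\<close>
  have K: "integrable (lborel \<Otimes>\<^sub>M lborel) (case_prod ?K)"
  proof (rule lborel_pair.Fubini_integrable)
    have "continuous_on UNIV (\<lambda>p. m (snd p) (fst p))"
      using continuous_on_compose2[OF cm continuous_on_Pair[OF continuous_on_snd[OF continuous_on_id]
            continuous_on_fst[OF continuous_on_id]]] by simp
    then have "continuous_on UNIV (\<lambda>p. v (fst p) * ?\<psi> (m (snd p) (fst p)))"
      by (intro continuous_on_mult continuous_on_compose2[OF Ck_on_imp_continuous[OF v]]
          continuous_on_compose2[OF c\<psi>]) (auto intro!: continuous_intros)
    from borel_measurable_continuous_onI[OF this]
    show "case_prod ?K \<in> borel_measurable (lborel \<Otimes>\<^sub>M lborel)"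
      by (simp add: lborel_prod case_prod_beta')
    show "integrable lborel (\<lambda>x. \<integral>\<alpha>. norm (case_prod ?K (x, \<alpha>)) \<partial>lborel)"
      using int by (simp add: abs_mult tr)
    show "AE x in lborel. integrable lborel (\<lambda>\<alpha>. case_prod ?K (x, \<alpha>))"
      by (simp add: tr)
  qed
  define G where "G \<alpha> = (\<integral>x. diff_op A b v x * \<phi> (m \<alpha> x) \<partial>lborel)" for \<alpha>
  have canc: "m \<alpha> (m (inver \<alpha>) y) = y" for \<alpha> y
    by (metis G.assoc G.group_left_neutral G.right_inverse)
  note gl = integral_left_translate[OF Lie_group_op_C(1)[OF m] canc cml inv left v \<phi>]
  have GK: "G \<alpha> = (\<integral>x. ?K x \<alpha> \<partial>lborel)" for \<alpha>
    unfolding G_def by (rule gl(2))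
  have "(\<integral>\<alpha>. G \<alpha> \<partial>lborel) = (\<integral>x. (\<integral>\<alpha>. ?K x \<alpha> \<partial>lborel) \<partial>lborel)"
    unfolding GK by (rule lborel_pair.Fubini_integral[OF K])
  also have "\<dots> = 0" by (simp add: tr)
  finally have "(\<integral>\<alpha>. G \<alpha> \<partial>lborel) = 0" .
  moreover have "integrable lborel G"
    unfolding GK[abs_def] by (rule lborel_pair.integrable_snd[OF K])
  moreover have "0 \<le> G \<alpha>" for \<alpha>
    unfolding G_def using sub \<phi>0(1) by (intro integral_nonneg_AE) simp
  ultimately have "AE \<alpha> in lborel. G \<alpha> = 0"
    by (subst (asm) integral_nonneg_eq_0_iff_AE) auto
  \<comment> \<open>The nonnegative integrand of \<open>G \<alpha>\<close> vanishes almost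
    everywhere. Its zero set is closed by continuity, and a closed set of full measure is the whole
    space, so the integrand vanishes at \<open>z\<close> too.\<close>
  moreover have "diff_op A b v z * \<phi> (m \<alpha> z) = 0" if "G \<alpha> = 0" for \<alpha>
  proof -
    let ?H = "\<lambda>x. diff_op A b v x * \<phi> (m \<alpha> x)"
    have "AE x in lborel. ?H x = 0"
      using that gl(1)[of \<alpha>] sub \<phi>0(1) unfolding G_def
      by (subst (asm) integral_nonneg_eq_0_iff_AE) auto
    then have ae: "AE x in lebesgue. x \<in> {x. ?H x = 0}"
    unfolding mem_Collect_eq by (rule AE_completion)
    have "closed {x. ?H x = 0}"
      by (intro closed_Collect_eq continuous_on_mult continuous_on_diff_op v continuous_on_const
          continuous_on_compose2[OF Ck_on_imp_continuous[OF \<phi>(1)] cml]) auto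
    from mem_closed_if_AE_lebesgue[OF this ae, of z] show ?thesis by simp
  qed
  ultimately have "AE \<alpha> in lborel. diff_op A b v z * \<phi> (m \<alpha> z) = 0"
    by (rule eventually_mono)
  then have ae: "AE \<alpha> in lebesgue. \<alpha> \<in> {\<alpha>. diff_op A b v z * \<phi> (m \<alpha> z) = 0}"
    unfolding mem_Collect_eq by (rule AE_completion)
  have "closed {\<alpha>. diff_op A b v z * \<phi> (m \<alpha> z) = 0}"
    by (intro closed_Collect_eq continuous_on_mult continuous_on_const
        continuous_on_compose2[OF Ck_on_imp_continuous[OF \<phi>(1)] cmr]) auto
  \<comment> \<open>The same closedness argument in \<open>\<alpha>\<close> allows any choice of
    \<open>\<alpha>\<close>; this one carries \<open>z\<close> to the origin, where the bump is
    positive. The factor 0 is there because the neutral element \<open>e\<close> may differ from the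
    origin.\<close>
  from mem_closed_if_AE_lebesgue[OF this ae, of "m 0 (inver z)"]
  have "diff_op A b v z * \<phi> (m (m 0 (inver z)) z) = 0" by simp
  moreover have "m (m 0 (inver z)) z = 0"
    by (metis G.assoc G.left_inverse G.right_neutral)
  ultimately show ?thesis using \<phi>0(2) by simp
qed

section \<open>From the semilinear equation to a subharmonic function\<close>

lemma (in diff_operator) diff_op_compose_real:
  assumes F: "\<And>t. (F has_real_derivative f t) (at t)" and f: "\<And>t. (f has_real_derivative f' t) (at t)"
    and u: "Ck_on 2 UNIV u"
  shows "diff_op A b (\<lambda>x. F (u x)) x =
    f' (u x) * ((A x *v gradient u x) \<bullet> gradient u x) + f (u x) * diff_op A b u x"
proof -
  note u' = Ck_on_1_has_derivative[OF Ck_on_2_imp_1[OF u]]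
  have chain: "((\<lambda>x. h (u x)) has_derivative (\<lambda>v. h' (u x) * frechet_derivative u (at x) v)) (at x)"
    if "\<And>t. (h has_real_derivative h' t) (at t)" for h h' :: "real \<Rightarrow> real" and x
    using has_derivative_compose[OF u' that[unfolded has_field_derivative_def]] .
  have pd: "partial_deriv i (\<lambda>x. h (u x)) x = h' (u x) * partial_deriv i u x"
    if "\<And>t. (h has_real_derivative h' t) (at t)" for h h' :: "real \<Rightarrow> real" and i x
    by (simp add: partial_deriv_eq[OF chain[OF that]] partial_deriv_def)
  have grad: "gradient (\<lambda>x. F (u x)) y = f (u y) *\<^sub>R gradient u y" for y
    by (simp add: gradient_def vec_eq_iff pd[OF F])
  let ?V = "\<lambda>i y. (A y *v gradient u y) $ i"
  have fu: "(\<lambda>x. f (u x)) differentiable (at x)" for x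
    using chain[OF f] by (auto simp: differentiable_def)
  \<comment> \<open>By \<open>grad\<close>, the flux of the composite is \<open>f (u y)\<close>
    times the flux of \<open>u\<close>. Differentiating the scalar factor yields, after summing over
    \<open>i\<close>, the quadratic form of \<open>A x\<close> at the gradient.\<close>
  have "partial_deriv i (\<lambda>y. (A y *v (f (u y) *\<^sub>R gradient u y)) $ i) x =
      f (u x) * partial_deriv i (?V i) x + f' (u x) * (partial_deriv i u x * ?V i x)" for i
    using partial_deriv_mult[OF fu Ck_on_1_differentiable[OF Ck_on_flux[OF A u]]]
    by (simp add: matrix_vector_mult_scaleR pd[OF f])
  then have "divergence (\<lambda>y. A y *v (f (u y) *\<^sub>R gradient u y)) x =
      f (u x) * divergence (\<lambda>y. A y *v gradient u y) x
        + f' (u x) * ((A x *v gradient u x) \<bullet> gradient u x)"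
    by (simp add: divergence_def sum.distrib sum_distrib_left inner_vec_def gradient_def mult_ac)
  then show ?thesis by (simp add: diff_op_def grad algebra_simps)
qed

theorem theorem1p5:
  fixes A :: "real^'n::finite \<Rightarrow> real^'n^'n"
    and b :: "real^'n \<Rightarrow> real^'n"
    and m :: "real^'n \<Rightarrow> real^'n \<Rightarrow> real^'n"
    and f F :: "real \<Rightarrow> real"
    and u :: "real^'n \<Rightarrow> real"
  assumes "\<And>i j. smooth_on UNIV (\<lambda>x. A x $ i $ j)"
    and "\<And>j. smooth_on UNIV (\<lambda>x. b x $ j)"
    and "\<And>x. transpose (A x) = A x"
    and "\<And>x \<xi>. (A x *v \<xi>) \<bullet> \<xi> \<ge> 0"
    and "trace (A 0) > 0"
    and "hypoelliptic A b"
    and "Lie_group_op m"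
    and "left_translation_invariant m (diff_op A b)"
    and "\<And>\<alpha>. distr lborel borel (\<lambda>x. m \<alpha> x) = lborel"
    and "\<And>\<alpha>. distr lborel borel (\<lambda>x. m x \<alpha>) = lborel"
    and "f C1_differentiable_on UNIV"
    and "mono f"
    and "f -` {0} = {0}"
    and "\<And>t. F t = (LBINT s=ereal 0..ereal t. f s)"
    and "Ck_on 2 UNIV u"
    and "\<And>x. diff_op A b u x = f (u x)"
    and "integrable lebesgue (\<lambda>x. F (u x))"
  shows "\<forall>x. u x = 0"
proof
  fix z
  interpret diff_operator A b
    using assms(1-3) by unfold_locales (simp_all add: smooth_on_def del: Ck_on.simps)
  note u = \<open>Ck_on 2 UNIV u\<close>
  obtain f' where f': "\<And>t. (f has_real_derivative f' t) (at t)" and cf': "continuous_on UNIV f'"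
    using \<open>f C1_differentiable_on UNIV\<close>
    by (auto simp: C1_differentiable_on_def has_real_derivative_iff_has_vector_derivative)
  have cf: "continuous_on UNIV f"
    using f' by (intro continuous_at_imp_continuous_on ballI DERIV_isCont)
  have F: "(F has_real_derivative f t) (at t)" for t
  proof -
    \<comment> \<open>The interval has both 0 and \<open>t\<close> in its interior, so the
      derivative within it is the two-sided derivative.\<close>
    let ?a = "- \<bar>t\<bar> - 1" and ?b = "\<bar>t\<bar> + 1"
    have "((\<lambda>t. LBINT s=ereal 0..ereal t. f s) has_vector_derivative f t) (at t within {?a..?b})"
      by (rule interval_integral_FTC2) (auto intro: continuous_on_subset[OF cf])
    moreover have "at t within {?a..?b} = at t"
      by (rule at_within_interior) auto
    ultimately show ?thesis
      by (simp add: assms(14)[abs_def] has_real_derivative_iff_has_vector_derivative)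
  qed
  have "Ck_on 2 UNIV F"
    unfolding numeral_2_eq_2
    by (intro Ck_on_Suc_realI[OF F] Ck_on_Suc_realI[OF f']) (simp add: cf')
  then have Fu: "Ck_on 2 UNIV (\<lambda>x. F (u x))" by (rule Ck_on_compose_real) (rule u)
  have "f' t \<ge> 0" for t
    by (rule mono_on_imp_deriv_nonneg[OF _ f', of UNIV]) (use \<open>mono f\<close> in auto)
  \<comment> \<open>The equation turns the last term of the chain rule into
    \<open>(f (u x))\<^sup>2\<close>; the quadratic term is nonnegative since \<open>f'\<close> is
    and \<open>A\<close> is positive semidefinite.\<close>
  then have L: "diff_op A b (\<lambda>x. F (u x)) x \<ge> (f (u x))\<^sup>2" for x
    using assms(4) by (simp add: diff_op_compose_real[OF F f' u] assms(16) power2_eq_square)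
  \<comment> \<open>Borel measurability allows integrability to pass from the completed measure to
    \<open>lborel\<close>.\<close>
  have "(\<lambda>x. F (u x)) \<in> borel_measurable lborel"
    using Ck_on_imp_continuous[OF Fu] by (simp add: borel_measurable_continuous_onI)
  then have "integrable lborel (\<lambda>x. F (u x))"
    using assms(17) by (simp add: integrable_completion)
  then have "diff_op A b (\<lambda>x. F (u x)) z = 0"
    using order_trans[OF zero_le_power2 L]
    by (rule integrable_subharmonic_imp_harmonic[OF assms(7-10) Fu])
  \<comment> \<open>The square of \<open>f (u z)\<close> is bounded above by a quantity just shown
    to be zero.\<close>
  then have "f (u z) = 0" using L[of z] by simp
  then show "u z = 0" using \<open>f -` {0} = {0}\<close> by blast
qed

end
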